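(* Let $k\geq 1$ be an integer and let $D$ be a multi-partite tournament. If $\delta^+(D)\geq 3k-2$, then $D$ contains $k$ pairwise vertex-disjoint dicycles.
   Context: All graphs are finite. A multi-partite tournament is an orientation of a complete multi-partite graph. A dicycle is a directed cycle, and $\delta^+(D)$ denotes the minimum out-degree of $D$. *)

theory Defs
  imports "Graph_Theory.Graph_Theory" "HOL-Library.Disjoint_Sets"
begin

(* Undirected simple graphs are symmetric digraphs, as in the AFP entry Graph_Theory.
   P is the set of parts; partition_on makes the parts nonempty, so P ~= {} just excludes
   the null graph (for which the minimum out-degree is undefined).  Any number of parts
   is allowed; a graph with a single part has no edges. *)
definition complete_multipartite_graph :: "('a, 'b) pre_digraph \<Rightarrow> bool" where
  "complete_multipartite_graph G \<longleftrightarrow> graph G \<and>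
     (\<exists>P. partition_on (verts G) P \<and> P \<noteq> {} \<and>
       arcs_ends G = {(u, v). \<exists>A\<in>P. \<exists>B\<in>P. A \<noteq> B \<and> u \<in> A \<and> v \<in> B})"

(* D arises from G by choosing exactly one of the arcs (u,v), (v,u) for every edge uv of G. *)
definition orientation_of :: "('a, 'b) pre_digraph \<Rightarrow> ('a, 'c) pre_digraph \<Rightarrow> bool" where
  "orientation_of D G \<longleftrightarrow> digraph D \<and> verts D = verts G \<and>
     arcs_ends D \<union> (arcs_ends D)\<inverse> = arcs_ends G \<and>
     arcs_ends D \<inter> (arcs_ends D)\<inverse> = {}"

(* The arcs of the underlying graph are taken to be pairs of vertices; since graphs have no
   parallel arcs, this loses no generality. *)
definition multipartite_tournament :: "('a, 'b) pre_digraph \<Rightarrow> bool" where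
  "multipartite_tournament D \<longleftrightarrow>
     (\<exists>G :: ('a, 'a \<times> 'a) pre_digraph. complete_multipartite_graph G \<and> orientation_of D G)"

(* Meaningful only for finite digraphs with at least one vertex. *)
definition min_out_degree :: "('a, 'b) pre_digraph \<Rightarrow> nat" where
  "min_out_degree D = Min (out_degree D ` verts D)"

(* For a nonempty walk p, awalk_verts u p does not depend on u. *)
definition cycle_verts :: "('a, 'b) pre_digraph \<Rightarrow> 'b awalk \<Rightarrow> 'a set" where
  "cycle_verts D p = set (pre_digraph.awalk_verts D (tail D (hd p)) p)"

end

theory Submission
  imports Defs
begin

text \<open>
  Pass to a terminal strong component, which keeps all out-degrees. If it has at least three parts,
  it contains a triangle (Bondy): otherwise take a shortest closed walk
  \<open>u \<rightarrow> v \<rightarrow> w \<rightarrow> \<dots> \<rightarrow> u\<close> with \<open>u, v, w\<close> in distinct parts. Then \<open>u \<rightarrow> w\<close>, and by minimality the walk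
  without \<open>v\<close> alternates between two parts; hence \<open>v\<close>, dominating \<open>w\<close>, must successively dominate all
  its vertices and finally \<open>u\<close>, a contradiction. If the component has only two parts, it contains a
  4-cycle, and no vertex dominates more than two vertices of it. In both cases deleting the
  cycle lowers out-degrees by at most 3, and induction on \<open>k\<close> applies.
\<close>

text \<open>Parts are the fibres of a labelling, so passing to a subset of \<open>V\<close> keeps
  \<open>part\<close> unchanged, even when some parts become empty.\<close>

locale multipartite_orientation =
  fixes V :: "'a set" and E :: "('a \<times> 'a) set" and part :: "'a \<Rightarrow> 'p"
  assumes asym: "(x, y) \<in> E \<Longrightarrow> (y, x) \<notin> E"
    and arcD: "(x, y) \<in> E \<Longrightarrow> x \<in> V \<and> y \<in> V \<and> part x \<noteq> part y"
    and adjacent: "\<lbrakk>x \<in> V; y \<in> V; part x \<noteq> part y\<rbrakk> \<Longrightarrow> (x, y) \<in> E \<or> (y, x) \<in> E"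

text \<open>Only the vertex set is kept, since disjointness and degree counts refer to nothing else.
  Distinctness of the vertices follows once \<open>E\<close> is asymmetric.\<close>

definition short_dicycle :: "('a \<times> 'a) set \<Rightarrow> 'a set \<Rightarrow> bool" where
  "short_dicycle E C \<longleftrightarrow>
     (\<exists>a b c. C = {a, b, c} \<and> {(a, b), (b, c), (c, a)} \<subseteq> E) \<or>
     (\<exists>a b c d. C = {a, b, c, d} \<and> {(a, b), (b, c), (c, d), (d, a)} \<subseteq> E)"

lemma relpow_segment:
  assumes "\<And>i. i < n \<Longrightarrow> (g i, g (Suc i)) \<in> R" "i \<le> j" "j \<le> n"
  shows "(g i, g j) \<in> R ^^ (j - i)"
  unfolding relpow_fun_conv
  by (rule exI[of _ "\<lambda>l. g (i + l)"]) (use assms in auto)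

section \<open>Short dicycles in a strong multipartite tournament\<close>

context multipartite_orientation
begin

lemma restrict:
  assumes "W \<subseteq> V"
  shows "multipartite_orientation W (Restr E W) part"
  using assms asym arcD adjacent by unfold_locales blast+

text \<open>Strong induction on \<open>m\<close> replaces the choice of a shortest closed
  walk.\<close>

lemma no_rainbow_closed_walk:
  assumes no_triangle: "\<nexists>a b c. {(a, b), (b, c), (c, a)} \<subseteq> E"
    and "(u, v) \<in> E" "(v, w) \<in> E" "part u \<noteq> part w" "(w, u) \<in> E ^^ m"
  shows False
  using assms(2-)
proof (induction m arbitrary: u v w rule: less_induct)
  case (less m)
  have uw: "(u, w) \<in> E"
    using adjacent no_triangle less.prems arcD by blast
  from less.prems(4) obtain f where f: "f 0 = w" "f m = u" "\<And>i. i < m \<Longrightarrow> (f i, f (Suc i)) \<in> E"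
    unfolding relpow_fun_conv by blast
  define g where "g = case_nat u f"
  have g: "g 0 = u" "g (Suc 0) = w" "g (Suc m) = u"
    using f by (simp_all add: g_def)
  have step: "(g i, g (Suc i)) \<in> E" if "i < Suc m" for i
    using that f uw by (cases i) (simp_all add: g_def)
  have "(v, g (Suc i)) \<in> E \<and> part (g i) \<noteq> part v" if "i \<le> m" for i
    using that
  proof (induction i)
    case 0
    then show ?case using g less.prems arcD by auto
  next
    case (Suc i)
    have e: "(g i, g (Suc i)) \<in> E" "(g (Suc i), g (Suc (Suc i))) \<in> E"
      using step Suc.prems by simp_all
    have "(g (Suc (Suc i)), g (Suc m)) \<in> E ^^ (m - Suc i)"
      using relpow_segment[of "Suc m" g E "Suc (Suc i)" "Suc m"] step Suc.prems by simp
    moreover have "(g (Suc m), g i) \<in> E ^^ i"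
      using relpow_segment[of "Suc m" g E 0 i] step Suc.prems g by simp
    \<comment> \<open>Continuing from \<open>g (i + 2)\<close> through \<open>u\<close> to
      \<open>g i\<close> takes \<open>m - 1\<close> arcs, so the induction hypothesis applies to the
      path \<open>g i\<close>, \<open>g (i + 1)\<close>, \<open>g (i + 2)\<close>.\<close>
    ultimately have "(g (Suc (Suc i)), g i) \<in> E ^^ (m - Suc i + i)"
      unfolding relpow_add by blast
    moreover have "m - Suc i + i < m" using Suc.prems by simp
    ultimately have eq: "part (g (Suc (Suc i))) = part (g i)"
      using less.IH e by metis
    from Suc have v: "(v, g (Suc i)) \<in> E" "part (g i) \<noteq> part v" by simp_all
    \<comment> \<open>Lying in the part of \<open>g i\<close>, the vertex \<open>g (i + 2)\<close>
      is adjacent to \<open>v\<close>; an arc towards \<open>v\<close> would close a triangle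
      through \<open>g (i + 1)\<close>.\<close>
    have "(v, g (Suc (Suc i))) \<in> E \<or> (g (Suc (Suc i)), v) \<in> E"
      using adjacent arcD[OF v(1)] arcD[OF e(2)] eq v(2) by metis
    then have "(v, g (Suc (Suc i))) \<in> E" using no_triangle v(1) e(2) by blast
    then show ?case using arcD[OF v(1)] by auto
  qed
  from this[of m] show False using g asym less.prems by auto
qed

lemma two_parts_of_no_triangle:
  assumes no_triangle: "\<nexists>a b c. {(a, b), (b, c), (c, a)} \<subseteq> E"
    and strong: "V \<times> V \<subseteq> E\<^sup>*"
  shows "\<lbrakk>(u, v) \<in> E; (v, w) \<in> E\<rbrakk> \<Longrightarrow> part u = part w"
    and "\<lbrakk>(u, v) \<in> E; x \<in> V\<rbrakk> \<Longrightarrow> part x = part u \<or> part x = part v"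
proof -
  show two: "part u = part w" if uvw: "(u, v) \<in> E" "(v, w) \<in> E" for u v w
  proof (rule ccontr)
    assume "part u \<noteq> part w"
    moreover obtain m where "(w, u) \<in> E ^^ m"
      using subsetD[OF strong, of "(w, u)"] arcD[OF uvw(1)] arcD[OF uvw(2)] unfolding rtrancl_power by blast
    ultimately show False using no_rainbow_closed_walk[OF no_triangle uvw] by blast
  qed
  assume uv: "(u, v) \<in> E" and "x \<in> V"
  then have "(v, x) \<in> E\<^sup>*" using strong arcD by blast
  \<comment> \<open>The predecessor \<open>y\<close> makes the claim inductive: the next vertex
    after \<open>x\<close> has the part of \<open>y\<close>, and \<open>x\<close> is then its
    predecessor.\<close>
  then have "\<exists>y. (y, x) \<in> E \<and> (part y = part u \<and> part x = part v \<or> part y = part v \<and> part x = part u)"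
  proof induction
    case base
    then show ?case using uv by blast
  next
    case (step x z)
    then show ?case using two by metis
  qed
  then show "part x = part u \<or> part x = part v" by blast
qed

text \<open>Let the return walk to \<open>u\<close> start with \<open>v\<close>, \<open>p\<close>,
  \<open>q\<close>. Then \<open>q\<close> shares the part of \<open>v\<close>, so \<open>u\<close>
  and \<open>q\<close> are adjacent: an arc from \<open>u\<close> to \<open>q\<close> leaves a
  return walk shorter by two, the opposite arc closes a 4-cycle.\<close>

lemma four_cycle_of_no_triangle:
  assumes no_triangle: "\<nexists>a b c. {(a, b), (b, c), (c, a)} \<subseteq> E"
    and strong: "V \<times> V \<subseteq> E\<^sup>*"
    and "(u, v) \<in> E"
  shows "\<exists>a b c d. {(a, b), (b, c), (c, d), (d, a)} \<subseteq> E"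
proof -
  note two = two_parts_of_no_triangle(1)[OF no_triangle strong]
  obtain m where "(v, u) \<in> E ^^ m"
    using subsetD[OF strong, of "(v, u)"] arcD[OF assms(3)] unfolding rtrancl_power by blast
  with assms(3) show ?thesis
  proof (induction m arbitrary: u v rule: less_induct)
    case (less m)
    \<comment> \<open>Return walks of length 0, 1 and 2 would give a loop, a pair of opposite arcs
      and a triangle.\<close>
    have "m \<noteq> 0" using less.prems arcD by (intro notI) auto
    moreover have "m \<noteq> 1" using less.prems asym by (intro notI) auto
    moreover have "m \<noteq> 2"
    proof
      assume "m = 2"
      then obtain p where "(v, p) \<in> E" "(p, u) \<in> E"
        using less.prems(2) by (auto simp: numeral_2_eq_2)
      then show False using less.prems(1) no_triangle by blast
    qed
    ultimately obtain n where n: "m = Suc (Suc (Suc n))"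
      by (metis One_nat_def Suc_1 not0_implies_Suc)
    obtain p q where pq: "(v, p) \<in> E" "(p, q) \<in> E" "(q, u) \<in> E ^^ Suc n"
      using less.prems(2) unfolding n by (meson relpow_Suc_D2)
    have "part q = part v" using two pq by metis
    then have "(u, q) \<in> E \<or> (q, u) \<in> E"
      using adjacent[of u q] arcD[OF less.prems(1)] arcD[OF pq(2)] by auto
    then show ?case
    proof
      assume "(u, q) \<in> E"
      then show ?thesis using less.IH[of "Suc n" u q] pq(3) n by simp
    next
      assume "(q, u) \<in> E"
      then show ?thesis using less.prems(1) pq by blast
    qed
  qed
qed

lemma short_dicycle_strong:
  assumes strong: "V \<times> V \<subseteq> E\<^sup>*" and "(u, v) \<in> E"
  shows "\<exists>C. short_dicycle E C \<and> (\<forall>x\<in>V. card (E `` {x} \<inter> C) \<le> 3)"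
proof (cases "\<exists>a b c. {(a, b), (b, c), (c, a)} \<subseteq> E")
  case True
  then obtain a b c where abc: "{(a, b), (b, c), (c, a)} \<subseteq> E" by blast
  have "card (E `` {x} \<inter> {a, b, c}) \<le> 3" for x
    by (rule order_trans[OF card_mono[of "{a, b, c}"]]) (auto simp: card_insert_if)
  with abc show ?thesis unfolding short_dicycle_def by blast
next
  case False
  note two = two_parts_of_no_triangle[OF False strong]
  obtain a b c d where abcd: "{(a, b), (b, c), (c, d), (d, a)} \<subseteq> E"
    using four_cycle_of_no_triangle[OF False strong assms(2)] by blast
  have "card (E `` {x} \<inter> {a, b, c, d}) \<le> 3" if "x \<in> V" for x
  proof -
    \<comment> \<open>A vertex sharing a part with \<open>a\<close> or \<open>b\<close> does not
      dominate that one, which leaves at most three of the four.\<close>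
    have "part x = part a \<or> part x = part b"
      using two(2)[of a b x] abcd that by simp
    then have "E `` {x} \<inter> {a, b, c, d} \<subseteq> {b, c, d} \<or> E `` {x} \<inter> {a, b, c, d} \<subseteq> {a, c, d}"
      using arcD by auto
    moreover have "card {b, c, d} \<le> 3" "card {a, c, d} \<le> 3" by (simp_all add: card_insert_if)
    ultimately show ?thesis by (meson card_mono finite.emptyI finite_insert order_trans)
  qed
  moreover have "short_dicycle E {a, b, c, d}" using abcd unfolding short_dicycle_def by metis
  ultimately show ?thesis by blast
qed

end

section \<open>Removing short dicycles one at a time\<close>

lemma short_dicycle_mono: "\<lbrakk>short_dicycle E C; E \<subseteq> F\<rbrakk> \<Longrightarrow> short_dicycle F C"
  unfolding short_dicycle_def by blast

lemma (in multipartite_orientation) short_dicycle_subset: "short_dicycle E C \<Longrightarrow> C \<subseteq> V"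
  unfolding short_dicycle_def using arcD by blast

text \<open>In a smallest nonempty successor-closed set, the vertices reachable from any given one
  form again such a set, hence all of it.\<close>

lemma terminal_strong_component:
  assumes "finite V" "V \<noteq> {}" "E \<subseteq> V \<times> V"
  obtains W where "W \<subseteq> V" "W \<noteq> {}" "E `` W \<subseteq> W"
    "W \<times> W \<subseteq> (Restr E W)\<^sup>*"
proof -
  define P where "P W \<longleftrightarrow> W \<subseteq> V \<and> W \<noteq> {} \<and> E `` W \<subseteq> W" for W
  have "P V" using assms by (auto simp: P_def)
  then obtain W where W: "P W" and min: "\<And>W'. P W' \<Longrightarrow> card W \<le> card W'"
    using ex_has_least_nat[of P V card] by blast
  have fin: "finite W" using W assms(1) finite_subset by (auto simp: P_def)
  have "(x, y) \<in> (Restr E W)\<^sup>*" if "x \<in> W" "y \<in> W" for x y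
  proof -
    let ?R = "(Restr E W)\<^sup>* `` {x}"
    have sub: "?R \<subseteq> W"
    proof
      fix z assume "z \<in> ?R"
      then have "(x, z) \<in> (Restr E W)\<^sup>*" by simp
      then show "z \<in> W" by (induction) (use that in auto)
    qed
    have "P ?R" unfolding P_def
    proof (intro conjI)
      show "?R \<subseteq> V" using sub W by (auto simp: P_def)
      show "E `` ?R \<subseteq> ?R"
      proof
        fix z assume "z \<in> E `` ?R"
        then obtain t where t: "(x, t) \<in> (Restr E W)\<^sup>*" "(t, z) \<in> E" by auto
        moreover have "t \<in> W" using sub t by blast
        moreover have "z \<in> W" using W \<open>t \<in> W\<close> t(2) by (auto simp: P_def)
        ultimately have "(x, z) \<in> (Restr E W)\<^sup>*" by (auto intro: rtrancl_into_rtrancl)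
        then show "z \<in> ?R" by simp
      qed
    qed auto
    then have "?R = W" using sub fin min by (simp add: card_seteq)
    then show ?thesis using that by auto
  qed
  then have "W \<times> W \<subseteq> (Restr E W)\<^sup>*" by auto
  with W show thesis using that unfolding P_def by blast
qed

text \<open>An empty \<open>V\<close> meets the degree bound vacuously, so nonemptiness is assumed,
  but only for \<open>k > 0\<close>: nothing may remain after the last dicycle is removed.\<close>

lemma disjoint_short_dicycles:
  assumes "multipartite_orientation V E part" "finite V" "k > 0 \<Longrightarrow> V \<noteq> {}"
    and "\<And>x. x \<in> V \<Longrightarrow> card (E `` {x}) \<ge> 3 * k - 2"
  shows "\<exists>C. (\<forall>i<k. short_dicycle E (C i)) \<and> disjoint_family_on C {..<k}"
  using assms
proof (induction k arbitrary: V E)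
  case 0
  then show ?case by (simp add: disjoint_family_on_def)
next
  case (Suc k)
  interpret multipartite_orientation V E part by fact
  have EV: "E \<subseteq> V \<times> V" using arcD by auto
  obtain W where W: "W \<subseteq> V" "W \<noteq> {}" "E `` W \<subseteq> W"
    and strong: "W \<times> W \<subseteq> (Restr E W)\<^sup>*"
    using terminal_strong_component[OF Suc.prems(2,3) EV] by blast
  interpret W: multipartite_orientation W "Restr E W" part using restrict W(1) .
  have fin: "finite W" using W(1) Suc.prems(2) finite_subset by blast
  \<comment> \<open>As \<open>W\<close> is successor-closed, out-neighbourhoods survive the
    restriction, and bounds found inside \<open>W\<close> hold for \<open>E\<close>.\<close>
  have img: "Restr E W `` {x} = E `` {x}" if "x \<in> W" for x using W(3) that by blast
  have deg: "card (E `` {x}) \<ge> 3 * k + 1" if "x \<in> W" for x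
    using Suc.prems(4)[of x] W(1) that by auto
  obtain u v where "(u, v) \<in> Restr E W"
  proof -
    obtain u where u: "u \<in> W" using W(2) by blast
    have "E `` {u} \<noteq> {}" using deg[OF u] by (intro notI) simp
    then show thesis using u W(3) that by blast
  qed
  then obtain C where C: "short_dicycle (Restr E W) C"
    and small: "\<And>x. x \<in> W \<Longrightarrow> card (E `` {x} \<inter> C) \<le> 3"
    using W.short_dicycle_strong[OF strong] img by metis
  let ?U = "W - C"
  interpret U: multipartite_orientation ?U "Restr E ?U" part
    using W(1) by (intro restrict) blast
  have degU: "card (Restr E ?U `` {x}) \<ge> 3 * k - 2" if "x \<in> ?U" for x
  proof -
    have eq: "Restr E ?U `` {x} = E `` {x} - C" using that W(3) by blast
    have "E `` {x} \<subseteq> W" using that W(3) by blast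
    then have "finite (E `` {x})" using fin finite_subset by blast
    then have "card (E `` {x} - C) = card (E `` {x}) - card (E `` {x} \<inter> C)"
      by (simp add: card_Diff_subset_Int)
    then show ?thesis unfolding eq using deg[of x] small[of x] that by simp
  qed
  \<comment> \<open>For \<open>k > 0\<close> a vertex of \<open>W\<close> has at least four
    successors, all in \<open>W\<close>, and at most three of them lie in \<open>C\<close>.\<close>
  have "?U \<noteq> {}" if "k > 0"
  proof
    assume "?U = {}"
    obtain x where x: "x \<in> W" using W(2) by blast
    have "E `` {x} \<subseteq> C" using W(3) x \<open>?U = {}\<close> by blast
    then have "E `` {x} \<inter> C = E `` {x}" by blast
    then show False using small[OF x] deg[OF x] that by simp
  qed
  then obtain B where B: "\<And>i. i < k \<Longrightarrow> short_dicycle (Restr E ?U) (B i)"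
      "disjoint_family_on B {..<k}"
    using Suc.IH[OF U.multipartite_orientation_axioms] fin degU by blast
  have "B i \<inter> C = {}" if "i < k" for i using U.short_dicycle_subset[OF B(1)[OF that]] by blast
  then have "disjoint_family_on (B(k := C)) {..<Suc k}"
    using B(2) by (fastforce simp: disjoint_family_on_def less_Suc_eq)
  moreover have "short_dicycle E ((B(k := C)) i)" if "i < Suc k" for i
    using that B(1) C by (auto simp: less_Suc_eq intro: short_dicycle_mono)
  ultimately show ?case by blast
qed

section \<open>Translation between vertex pairs and digraphs\<close>

lemma short_dicycle_cycle:
  assumes "wf_digraph D" and asym: "\<And>x y. (x, y) \<in> arcs_ends D \<Longrightarrow> (y, x) \<notin> arcs_ends D"
    and "short_dicycle (arcs_ends D) C"
  shows "\<exists>p. pre_digraph.cycle D p \<and> cycle_verts D p = C"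
proof -
  interpret wf_digraph D by fact
  from assms(3) consider
      (triangle) a b c where "C = {a, b, c}" "{(a, b), (b, c), (c, a)} \<subseteq> arcs_ends D"
    | (square) a b c d where "C = {a, b, c, d}" "{(a, b), (b, c), (c, d), (d, a)} \<subseteq> arcs_ends D"
    unfolding short_dicycle_def by blast
  then show ?thesis
  proof cases
    case triangle
    from triangle(2) obtain e f g where "e \<in> arcs D" "f \<in> arcs D" "g \<in> arcs D"
      "tail D e = a" "head D e = b" "tail D f = b" "head D f = c" "tail D g = c" "head D g = a"
      by (simp, elim conjE reachableE) blast
    moreover have "a \<noteq> b" "b \<noteq> c" "c \<noteq> a" using triangle(2) asym by auto
    ultimately have "cycle [e, f, g] \<and> cycle_verts D [e, f, g] = C"
      using triangle(1) by (auto simp: cycle_def cycle_verts_def awalk_def)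
    then show ?thesis ..
  next
    case square
    from square(2) obtain e f g h where "e \<in> arcs D" "f \<in> arcs D" "g \<in> arcs D" "h \<in> arcs D"
      "tail D e = a" "head D e = b" "tail D f = b" "head D f = c"
      "tail D g = c" "head D g = d" "tail D h = d" "head D h = a"
      by (simp, elim conjE reachableE) blast
    \<comment> \<open>Equal consecutive vertices would give a loop, equal opposite corners a pair of
      opposite arcs; \<open>asym\<close> excludes both.\<close>
    moreover have "a \<noteq> b" "b \<noteq> c" "c \<noteq> d" "d \<noteq> a" "a \<noteq> c" "b \<noteq> d"
      using square(2) asym by auto
    ultimately have "cycle [e, f, g, h] \<and> cycle_verts D [e, f, g, h] = C"
      using square(1) by (auto simp: cycle_def cycle_verts_def awalk_def)
    then show ?thesis ..
  qed
qed

text \<open>Without parallel arcs, an arc leaving \<open>v\<close> is determined by its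
  head.\<close>

lemma (in nomulti_digraph) card_successors: "card (arcs_ends G `` {v}) = out_degree G v"
proof -
  have "arcs_ends G `` {v} = head G ` out_arcs G v"
    by (auto simp: arcs_ends_conv)
  moreover have "inj_on (head G) (out_arcs G v)"
    by (auto intro!: inj_onI no_multi_arcs simp: arc_to_ends_def)
  ultimately show ?thesis by (simp add: card_image out_degree_def)
qed

text \<open>Each vertex is labelled by its own block, which is unique because blocks are
  disjoint.\<close>

lemma multipartite_orientation_of_partition:
  assumes "partition_on V P"
    and ends: "E \<union> E\<inverse> = {(u, v). \<exists>A\<in>P. \<exists>B\<in>P. A \<noteq> B \<and> u \<in> A \<and> v \<in> B}"
    and "E \<inter> E\<inverse> = {}"
  shows "multipartite_orientation V E (\<lambda>x. THE A. A \<in> P \<and> x \<in> A)"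
proof -
  define part where "part x = (THE A. A \<in> P \<and> x \<in> A)" for x
  have eq: "part x = A" if "A \<in> P" "x \<in> A" for x A
    unfolding part_def using that assms(1)
    by (intro the_equality) (auto simp: partition_on_def disjoint_def)
  have "multipartite_orientation V E part"
  proof
    fix x y
    show "(y, x) \<notin> E" if "(x, y) \<in> E" using that assms(3) by blast
    show "x \<in> V \<and> y \<in> V \<and> part x \<noteq> part y" if "(x, y) \<in> E"
    proof -
      have "(x, y) \<in> E \<union> E\<inverse>" using that by blast
      then show ?thesis unfolding ends using eq assms(1) by (auto simp: partition_on_def)
    qed
    show "(x, y) \<in> E \<or> (y, x) \<in> E" if xy: "x \<in> V" "y \<in> V" "part x \<noteq> part y"
    proof -
      obtain A B where "A \<in> P" "B \<in> P" "x \<in> A" "y \<in> B"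
        using xy(1,2) assms(1) by (auto simp: partition_on_def)
      then have "(x, y) \<in> E \<union> E\<inverse>" unfolding ends using xy(3) eq by blast
      then show ?thesis by blast
    qed
  qed
  then show ?thesis by (simp add: part_def[abs_def])
qed

theorem corollary14:
  fixes D :: "('a, 'b) pre_digraph" and k :: nat
  assumes "k \<ge> 1"
    and "multipartite_tournament D"
    and "min_out_degree D \<ge> 3 * k - 2"
  shows "\<exists>c :: nat \<Rightarrow> 'b awalk.
           (\<forall>i<k. pre_digraph.cycle D (c i)) \<and>
           disjoint_family_on (\<lambda>i. cycle_verts D (c i)) {..<k}"
proof -
  obtain G :: "('a, 'a \<times> 'a) pre_digraph" and P where P: "partition_on (verts G) P" "P \<noteq> {}"
      "arcs_ends G = {(u, v). \<exists>A\<in>P. \<exists>B\<in>P. A \<noteq> B \<and> u \<in> A \<and> v \<in> B}"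
    and or: "orientation_of D G"
    using assms(2) unfolding multipartite_tournament_def complete_multipartite_graph_def by blast
  from or have D: "digraph D" "verts D = verts G"
      "arcs_ends D \<union> (arcs_ends D)\<inverse> = arcs_ends G" "arcs_ends D \<inter> (arcs_ends D)\<inverse> = {}"
    by (simp_all add: orientation_of_def)
  interpret digraph D by fact
  interpret multipartite_orientation "verts D" "arcs_ends D" "\<lambda>x. THE A. A \<in> P \<and> x \<in> A"
    by (rule multipartite_orientation_of_partition) (use P D in simp_all)
  \<comment> \<open>There is at least one block, and blocks of a partition are nonempty.\<close>
  have "verts D \<noteq> {}" using P D(2) by (auto simp: partition_on_def)
  moreover have "card (arcs_ends D `` {x}) \<ge> 3 * k - 2" if "x \<in> verts D" for x
    using assms(3) that unfolding card_successors min_out_degree_def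
    by (meson Min_le finite_imageI finite_verts imageI order_trans)
  ultimately obtain C where C: "\<And>i. i < k \<Longrightarrow> short_dicycle (arcs_ends D) (C i)"
      "disjoint_family_on C {..<k}"
    using disjoint_short_dicycles[OF multipartite_orientation_axioms, of k] by auto
  have "\<exists>p. cycle p \<and> cycle_verts D p = C i" if "i < k" for i
    using short_dicycle_cycle[OF wf_digraph asym C(1)[OF that]] by blast
  then obtain c where "\<And>i. i < k \<Longrightarrow> cycle (c i) \<and> cycle_verts D (c i) = C i" by metis
  with C(2) show ?thesis by (intro exI[of _ c]) (simp add: disjoint_family_on_def)
qed

end
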